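(* Let $(\mathcal S,\mathcal A,\lambda)$ be the mixture measure space of a countable family of disjoint $\sigma$-finite measure spaces $(\mathcal S_i,\mathcal A_i,\lambda_i)_{i\in\mathcal D}$, let $\pi$ be a probability measure on $(\mathcal S,\mathcal A)$ with density $p$ w.r.t. $\lambda$, and let $\mathcal M$ be a finite or countable set of moves with move probabilities $q_\ell$ and a bijection $r:\mathcal M\to\mathcal M$, $\ell\mapsto r_\ell$, with $r_{r_\ell}=\ell$, assigning to each move its unique backward move. Suppose every move is a post-hoc translation: for a move $\ell$ from $\mathcal S_j$ to $\mathcal S_i$ there are a $\sigma$-finite measure space $(\mathcal U_\ell,\mathcal B_\ell,\nu_\ell)$, a kernel density $k_\ell$ from $(\mathcal S_j,\mathcal A_j)$ to $(\mathcal U_\ell,\mathcal B_\ell,\nu_\ell)$ and a measurable function $\mathbf s_\ell:\mathcal S_j\times\mathcal U_\ell\to\mathcal S_i$. Assume that for every move $\ell\in\mathcal M$, with transitions from $\mathcal S_j$ to $\mathcal S_i$, there exist measurable functions $\mathbf u_\ell:\mathcal S_j\times\mathcal U_\ell\to\mathcal U_{r_\ell}$ and $f_\ell:\mathcal S_j\times\mathcal U_\ell\to\mathbb R_{\ge 0}$ such that, writing $(\mathbf s,\mathbf u)_\ell=(\mathbf s_\ell,\mathbf u_\ell):\mathcal S_j\times\mathcal U_\ell\to\mathcal S_i\times\mathcal U_{r_\ell}$, (I) $(\mathbf s,\mathbf u)_\ell=(\mathbf s,\mathbf u)_{r_\ell}^{-1}$ (the two maps are mutually inverse bijections); (II) $\lambda_i\otimes\nu_{r_\ell}\big((\mathbf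 s,\mathbf u)_\ell(ds',du')\big)=f_\ell(s',u')\,\lambda_j\otimes\nu_\ell(ds',du')$, i.e. $\lambda_i\otimes\nu_{r_\ell}\big((\mathbf s,\mathbf u)_\ell(C)\big)=\int_C f_\ell\,d(\lambda_j\otimes\nu_\ell)$ for all $C\in\mathcal A_j\otimes\mathcal B_\ell$. Then the transition kernel $$\mu(s',\cdot)=\sum_{\ell\in\mathcal M}q_\ell(s')\int\Big(a^\ell_{s'u'}\,\delta_{\mathbf s_\ell(s',u')}(\cdot)+\big(1-a^\ell_{s'u'}\big)\delta_{s'}(\cdot)\Big)k_\ell(s',u')\,\nu_\ell(du')$$ with $$a^\ell_{s'u'}=\min\left\{1,\ \frac{p(\mathbf s_\ell(s',u'))\,k_{r_\ell}\big((\mathbf s,\mathbf u)_\ell(s',u')\big)}{p(s')\,k_\ell(s',u')}\cdot\frac{q_{r_\ell}(\mathbf s_\ell(s',u'))}{q_\ell(s')}\cdot f_\ell(s',u')\right\}$$ preserves the detailed balance condition w.r.t. $\pi$.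
   Context: Mixture measure space: $\mathcal D$ is a finite or countable set, $(\mathcal S_i,\mathcal A_i,\lambda_i)_{i\in\mathcal D}$ are $\sigma$-finite measure spaces with pairwise disjoint $\mathcal S_i$; $\mathcal S=\bigcup_{i}\mathcal S_i$, $\mathcal A=\sigma(\bigcup_i\mathcal A_i)$, $\lambda=\sum_{i}\lambda_i\circ\mathrm{id}_i^{-1}$, where $\mathrm{id}_i:\mathcal S_i\to\mathcal S$ is the inclusion. Moves: each move $\ell\in\mathcal M$ transitions from one space $\mathcal S_j$ to one space $\mathcal S_i$ (both depending on $\ell$, possibly $i=j$), and its backward move $r_\ell$ transitions from $\mathcal S_i$ to $\mathcal S_j$. The move probabilities $q_\ell:\mathcal S\to[0,1]$ are measurable with $\sum_{\ell\in\mathcal M}q_\ell(s')=1$ for all $s'\in\mathcal S$, and $q_\ell(s')=0$ if $s'\notin\mathcal S_j$; for such $s'$ the term of move $\ell$ in $\mu$ is $0$. In move $\ell$, given $s'\in\mathcal S_j$, one draws $u'\in\mathcal U_\ell$ from $k_\ell(s',u')\nu_\ell(du')$ and proposes $\mathbf s_\ell(s',u')$. Kernel density from $(\mathcal S_j,\mathcal A_j)$ to $(\mathcal U_\ell,\mathcal B_\ell,\nu_\ell)$: a jointly measurable $k_\ell:\mathcal S_j\times\mathcal U_\ell\to[0,\infty)$ with $\int k_\ell(s',u')\nu_\ell(du')=1$ for all $s'\in\mathcal S_j$. Convention: an acceptance probability is set to $0$ wherever its defining expression is not defined (zero denominator). Detailed balance: a Markov kernel $\mu$ on $(\mathcal S,\mathcal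 A)$ preserves the detailed balance condition w.r.t. $\pi$ if $\pi\otimes\mu(A\times B)=\pi\otimes\mu(B\times A)$ for all $A,B\in\mathcal A$, where $\pi\otimes\mu(A\times B)=\int_A\mu(s',B)\,\pi(ds')$. *)

theory Defs
  imports "HOL-Probability.Probability"
begin

text \<open>All components live on subsets \<open>space (lam i)\<close> of one carrier type, so the preimage of \<open>A\<close>
  under the inclusion of the \<open>i\<close>-th component is \<open>A \<inter> space (lam i)\<close>. For pairwise disjoint
  components the set function is a measure, see \<open>emeasure_mixture_measure\<close> below.\<close>

definition mixture_measure :: "'i set \<Rightarrow> ('i \<Rightarrow> 'a measure) \<Rightarrow> 'a measure" where
  "mixture_measure D lam =
     measure_of (\<Union>i\<in>D. space (lam i)) (\<Union>i\<in>D. sets (lam i))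
       (\<lambda>A. \<integral>\<^sup>+ i. emeasure (lam i) (A \<inter> space (lam i)) \<partial>count_space D)"

lemma space_mixture_measure: "space (mixture_measure D lam) = (\<Union>i\<in>D. space (lam i))"
  unfolding mixture_measure_def
  by (rule space_measure_of) (use sets.sets_into_space in blast)

lemma sets_mixture_measure:
  "sets (mixture_measure D lam) = sigma_sets (\<Union>i\<in>D. space (lam i)) (\<Union>i\<in>D. sets (lam i))"
  unfolding mixture_measure_def
  by (rule sets_measure_of) (use sets.sets_into_space in blast)

lemma sets_mixture_measure_component:
  assumes disj: "disjoint_family_on (\<lambda>i. space (lam i)) D" and i: "i \<in> D"
    and A: "A \<in> sets (mixture_measure D lam)"
  shows "A \<inter> space (lam i) \<in> sets (lam i)"
  using A unfolding sets_mixture_measure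
proof (induction rule: sigma_sets.induct)
  case (Basic a)
  then obtain j where j: "j \<in> D" "a \<in> sets (lam j)" by auto
  show ?case
  proof (cases "i = j")
    case True
    then show ?thesis using j by auto
  next
    case False
    then have "space (lam j) \<inter> space (lam i) = {}"
      using disj i j(1) by (auto simp: disjoint_family_on_def)
    then have "a \<inter> space (lam i) = {}"
      using sets.sets_into_space[OF j(2)] by blast
    then show ?thesis by simp
  qed
next
  case Empty
  then show ?case by simp
next
  case (Compl a)
  have "((\<Union>i\<in>D. space (lam i)) - a) \<inter> space (lam i) = space (lam i) - (a \<inter> space (lam i))"
    using i by auto
  then show ?case using Compl.IH by auto
next
  case (Union a)
  have "(\<Union>n. a n) \<inter> space (lam i) = (\<Union>n. a n \<inter> space (lam i))" by auto
  moreover have "(\<Union>n. a n \<inter> space (lam i)) \<in> sets (lam i)"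
    by (rule sets.countable_UN) (use Union.IH in blast)
  ultimately show ?case by simp
qed

lemma emeasure_mixture_measure:
  assumes disj: "disjoint_family_on (\<lambda>i. space (lam i)) D"
    and A: "A \<in> sets (mixture_measure D lam)"
  shows "emeasure (mixture_measure D lam) A =
    (\<integral>\<^sup>+ i. emeasure (lam i) (A \<inter> space (lam i)) \<partial>count_space D)"
proof (rule emeasure_measure_of[OF mixture_measure_def _ _ _ A])
  show "(\<Union>i\<in>D. sets (lam i)) \<subseteq> Pow (\<Union>i\<in>D. space (lam i))"
    using sets.sets_into_space by blast
  show "positive (sets (mixture_measure D lam))
     (\<lambda>A. \<integral>\<^sup>+ i. emeasure (lam i) (A \<inter> space (lam i)) \<partial>count_space D)"
    by (simp add: positive_def)
  show "countably_additive (sets (mixture_measure D lam))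
     (\<lambda>A. \<integral>\<^sup>+ i. emeasure (lam i) (A \<inter> space (lam i)) \<partial>count_space D)"
  proof (rule countably_additiveI)
    fix F :: "nat \<Rightarrow> 'b set"
    assume F: "range F \<subseteq> sets (mixture_measure D lam)" and d: "disjoint_family F"
    have "(\<Sum>n. \<integral>\<^sup>+ i. emeasure (lam i) (F n \<inter> space (lam i)) \<partial>count_space D)
        = (\<integral>\<^sup>+ i. (\<Sum>n. emeasure (lam i) (F n \<inter> space (lam i))) \<partial>count_space D)"
      by (rule nn_integral_suminf[symmetric]) simp
    also have "\<dots> = (\<integral>\<^sup>+ i. emeasure (lam i) ((\<Union>n. F n) \<inter> space (lam i)) \<partial>count_space D)"
    proof (rule nn_integral_cong)
      fix i assume "i \<in> space (count_space D)"
      then have i: "i \<in> D" by simp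
      have "(\<Sum>n. emeasure (lam i) (F n \<inter> space (lam i)))
          = emeasure (lam i) (\<Union>n. F n \<inter> space (lam i))"
      proof (rule suminf_emeasure)
        show "range (\<lambda>n. F n \<inter> space (lam i)) \<subseteq> sets (lam i)"
          using sets_mixture_measure_component[OF disj i] F by blast
        show "disjoint_family (\<lambda>n. F n \<inter> space (lam i))"
          using d unfolding disjoint_family_on_def by blast
      qed
      then show "(\<Sum>n. emeasure (lam i) (F n \<inter> space (lam i)))
          = emeasure (lam i) ((\<Union>n. F n) \<inter> space (lam i))"
        by simp
    qed
    finally show "(\<Sum>n. \<integral>\<^sup>+ i. emeasure (lam i) (F n \<inter> space (lam i)) \<partial>count_space D)
        = (\<integral>\<^sup>+ i. emeasure (lam i) ((\<Union>n. F n) \<inter> space (lam i)) \<partial>count_space D)" .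
  qed
qed

definition kernel_density :: "'s measure \<Rightarrow> 'u measure \<Rightarrow> ('s \<times> 'u \<Rightarrow> real) \<Rightarrow> bool" where
  "kernel_density M N k \<longleftrightarrow>
     k \<in> borel_measurable (M \<Otimes>\<^sub>M N) \<and>
     (\<forall>x\<in>space (M \<Otimes>\<^sub>M N). 0 \<le> k x) \<and>
     (\<forall>s\<in>space M. (\<integral>\<^sup>+ u. ennreal (k (s, u)) \<partial>N) = 1)"

definition markov_kernel :: "'s measure \<Rightarrow> ('s \<Rightarrow> 's measure) \<Rightarrow> bool" where
  "markov_kernel M \<mu> \<longleftrightarrow> \<mu> \<in> measurable M (prob_algebra M)"

text \<open>The joint measure of a rectangle \<open>A \<times> B\<close> under \<open>P\<close> followed by \<open>\<mu>\<close>.\<close>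

definition kernel_rect :: "'s measure \<Rightarrow> ('s \<Rightarrow> 's measure) \<Rightarrow> 's set \<Rightarrow> 's set \<Rightarrow> ennreal" where
  "kernel_rect P \<mu> A B = (\<integral>\<^sup>+ s\<in>A. emeasure (\<mu> s) B \<partial>P)"

text \<open>Being a Markov kernel is part of the notion. In particular, this rules out that a kernel
  introduced with \<^const>\<open>measure_of\<close> has silently degenerated to the null measure.\<close>

definition preserves_detailed_balance ::
    "'s measure \<Rightarrow> 's measure \<Rightarrow> ('s \<Rightarrow> 's measure) \<Rightarrow> bool" where
  "preserves_detailed_balance M P \<mu> \<longleftrightarrow>
     markov_kernel M \<mu> \<and>
     (\<forall>A\<in>sets M. \<forall>B\<in>sets M. kernel_rect P \<mu> A B = kernel_rect P \<mu> B A)"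

definition move_map :: "('l \<Rightarrow> 's \<times> 'u \<Rightarrow> 's) \<Rightarrow> ('l \<Rightarrow> 's \<times> 'u \<Rightarrow> 'u) \<Rightarrow> 'l \<Rightarrow> 's \<times> 'u \<Rightarrow> 's \<times> 'u" where
  "move_map sm um l x = (sm l x, um l x)"

text \<open>The first branch is the convention that the acceptance probability is 0 where a
  denominator vanishes.\<close>

definition acceptance ::
    "('s \<Rightarrow> real) \<Rightarrow> ('l \<Rightarrow> 's \<Rightarrow> real) \<Rightarrow> ('l \<Rightarrow> 'l) \<Rightarrow> ('l \<Rightarrow> 's \<times> 'u \<Rightarrow> real) \<Rightarrow>
     ('l \<Rightarrow> 's \<times> 'u \<Rightarrow> 's) \<Rightarrow> ('l \<Rightarrow> 's \<times> 'u \<Rightarrow> 'u) \<Rightarrow> ('l \<Rightarrow> 's \<times> 'u \<Rightarrow> real) \<Rightarrow>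
     'l \<Rightarrow> 's \<Rightarrow> 'u \<Rightarrow> real" where
  "acceptance p q r k sm um f l s u =
     (if p s * k l (s, u) = 0 \<or> q l s = 0 then 0
      else min 1 (p (sm l (s, u)) * k (r l) (move_map sm um l (s, u)) / (p s * k l (s, u))
                  * (q (r l) (sm l (s, u)) / q l s) * f l (s, u)))"

text \<open>The transition kernel of the mixture of moves: \<open>\<Lambda>\<close> is the measure on the whole state space
  and \<open>N l\<close> is the component from which move \<open>l\<close> starts.\<close>

definition transition_kernel ::
    "'s measure \<Rightarrow> 'l set \<Rightarrow> ('l \<Rightarrow> 's measure) \<Rightarrow> ('l \<Rightarrow> 'u measure) \<Rightarrow> ('l \<Rightarrow> 's \<Rightarrow> real) \<Rightarrow>
     ('l \<Rightarrow> 's \<times> 'u \<Rightarrow> real) \<Rightarrow> ('l \<Rightarrow> 's \<times> 'u \<Rightarrow> 's) \<Rightarrow> ('l \<Rightarrow> 's \<Rightarrow> 'u \<Rightarrow> real) \<Rightarrow>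
     's \<Rightarrow> 's measure" where
  "transition_kernel \<Lambda> M N \<nu> q k sm a s =
     measure_of (space \<Lambda>) (sets \<Lambda>) (\<lambda>B. \<integral>\<^sup>+ l.
       (if s \<in> space (N l)
        then ennreal (q l s) *
          (\<integral>\<^sup>+ u. (ennreal (a l s u) * emeasure (return \<Lambda> (sm l (s, u))) B
                + ennreal (1 - a l s u) * emeasure (return \<Lambda> s) B)
               * ennreal (k l (s, u)) \<partial>\<nu> l)
        else 0) \<partial>count_space M)"

end

theory Submission
  imports Defs
begin

text \<open>Put \<open>g\<^sub>\<ell> = p q\<^sub>\<ell> k\<^sub>\<ell>\<close> and \<open>T\<^sub>\<ell> = (s, u)\<^sub>\<ell>\<close>. The mass that move \<open>\<ell>\<close> proposes and
  accepts has density \<open>min (g\<^sub>\<ell>) ((g\<^sub>r \<circ> T\<^sub>\<ell>) f\<^sub>\<ell>)\<close>, where \<open>r\<close> is the backward move of \<open>\<ell>\<close>.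
  The two image measure conditions give \<open>(f\<^sub>r \<circ> T\<^sub>\<ell>) f\<^sub>\<ell> = 1\<close> almost everywhere, so the change of
  variables \<open>T\<^sub>\<ell>\<close> turns the density of the accepted mass of \<open>r\<close> into that of \<open>\<ell>\<close>, with the roles of the
  start set and the target set exchanged. Summing over all moves and reindexing by \<open>r\<close> gives the balance
  of the accepted mass; the rejected mass stays on the diagonal and is trivially balanced.\<close>

section \<open>The mixture measure on a single component\<close>

lemma space_component_in_sets_mixture_measure:
  assumes "i \<in> D"
  shows "space (lam i) \<in> sets (mixture_measure D lam)"
  unfolding sets_mixture_measure using assms by (intro sigma_sets.Basic) auto

text \<open>A subset of the i-th component meets no other component, so a single summand of the
  mixture survives on it. This lets an integral over the mixture of a function supported in one
  component be computed over that component alone.\<close>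

lemma restrict_space_mixture_measure:
  assumes disj: "disjoint_family_on (\<lambda>i. space (lam i)) D" and i: "i \<in> D"
  shows "restrict_space (mixture_measure D lam) (space (lam i)) = lam i"
proof (rule measure_eqI)
  have S: "space (lam i) \<inter> space (mixture_measure D lam) \<in> sets (mixture_measure D lam)"
    using space_component_in_sets_mixture_measure[OF i] by (intro sets.Int) auto
  show sets_eq: "sets (restrict_space (mixture_measure D lam) (space (lam i))) = sets (lam i)"
  proof (intro equalityI subsetI)
    fix A assume "A \<in> sets (restrict_space (mixture_measure D lam) (space (lam i)))"
    then obtain B where B: "B \<in> sets (mixture_measure D lam)" "A = space (lam i) \<inter> B"
      by (auto simp: sets_restrict_space)
    show "A \<in> sets (lam i)"
      using sets_mixture_measure_component[OF disj i B(1)] by (simp add: B(2) Int_commute)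
  next
    fix A assume A: "A \<in> sets (lam i)"
    then have "A \<in> sets (mixture_measure D lam)"
      unfolding sets_mixture_measure using i by (intro sigma_sets.Basic) auto
    moreover have "A \<subseteq> space (lam i)"
      using A by (rule sets.sets_into_space)
    ultimately show "A \<in> sets (restrict_space (mixture_measure D lam) (space (lam i)))"
      by (subst sets_restrict_space_iff[OF S]) auto
  qed
  fix A assume "A \<in> sets (restrict_space (mixture_measure D lam) (space (lam i)))"
  then have A: "A \<in> sets (lam i)" by (simp add: sets_eq)
  then have sub: "A \<subseteq> space (lam i)"
    by (rule sets.sets_into_space)
  have A': "A \<in> sets (mixture_measure D lam)"
    unfolding sets_mixture_measure using i A by (intro sigma_sets.Basic) auto
  have "emeasure (restrict_space (mixture_measure D lam) (space (lam i))) A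
      = (\<integral>\<^sup>+ j. emeasure (lam j) (A \<inter> space (lam j)) \<partial>count_space D)"
    by (simp add: emeasure_restrict_space[OF S sub] emeasure_mixture_measure[OF disj A'])
  also have "\<dots> = (\<integral>\<^sup>+ j. emeasure (lam i) A * indicator {i} j \<partial>count_space D)"
  proof (rule nn_integral_cong)
    fix j assume "j \<in> space (count_space D)"
    then have "j \<noteq> i \<Longrightarrow> A \<inter> space (lam j) = {}"
      using disj i sub by (auto simp: disjoint_family_on_def)
    moreover have "A \<inter> space (lam i) = A" using sub by auto
    ultimately show "emeasure (lam j) (A \<inter> space (lam j)) = emeasure (lam i) A * indicator {i} j"
      by (cases "j = i") auto
  qed
  also have "\<dots> = emeasure (lam i) A"
    using i by (subst nn_integral_cmult) auto
  finally show "emeasure (restrict_space (mixture_measure D lam) (space (lam i))) A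
      = emeasure (lam i) A" .
qed

section \<open>Countable sums as integrals over counting measures\<close>

lemma borel_measurable_nn_integral_count_space:
  fixes g :: "'i \<Rightarrow> 'a \<Rightarrow> ennreal"
  assumes "countable I" and meas: "\<And>i. i \<in> I \<Longrightarrow> g i \<in> borel_measurable N"
  shows "(\<lambda>x. \<integral>\<^sup>+ i. g i x \<partial>count_space I) \<in> borel_measurable N"
proof -
  interpret sigma_finite_measure "count_space I"
    by (rule sigma_finite_measure_count_space_countable) fact
  \<comment> \<open>The second coordinate takes values in a countable set, so joint measurability
    reduces to measurability for each fixed index. The counting measure being sigma-finite, the
    inner integral is then measurable by Tonelli.\<close>
  have "(\<lambda>z. g (snd z) (fst z)) \<in> borel_measurable (N \<Otimes>\<^sub>M count_space I)"
    by (rule measurable_compose_countable'[where f = "\<lambda>i z. g i (fst z)" and I = I])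
       (use assms in \<open>auto intro: measurable_compose[OF measurable_fst]\<close>)
  from borel_measurable_nn_integral_fst[OF this] show ?thesis by simp
qed

text \<open>Nonnegative terms equal their norms, so summability is absolute summability, for which
  the sum is an integral over the counting measure. It carries the real-valued normalisation of the
  move probabilities over to the \<open>ennreal\<close> sum that defines the kernel.\<close>

lemma has_sum_imp_nn_integral_count_space:
  fixes g :: "'i \<Rightarrow> real"
  assumes sum: "(g has_sum c) I" and nonneg: "\<And>i. i \<in> I \<Longrightarrow> 0 \<le> g i"
  shows "(\<integral>\<^sup>+ i. ennreal (g i) \<partial>count_space I) = ennreal c"
proof -
  have "(\<lambda>i. norm (g i)) summable_on I"
    using has_sum_imp_summable[OF sum] nonneg by (simp cong: summable_on_cong)
  then have "Infinite_Set_Sum.abs_summable_on g I"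
    by (simp only: abs_summable_equivalent)
  then show ?thesis
    using nonneg infsumI[OF sum] by (simp add: nn_integral_conv_infsetsum infsetsum_infsum)
qed

section \<open>Change of variables from the image measure condition\<close>

lemma distr_density_image_measure:
  assumes T: "T \<in> measurable X Y" and bij: "bij_betw T (space X) (space Y)"
    and f: "f \<in> borel_measurable X"
    and image: "\<And>C. C \<in> sets X \<Longrightarrow> emeasure Y (T ` C) = (\<integral>\<^sup>+ x\<in>C. f x \<partial>X)"
  shows "distr (density X f) Y T = Y"
proof (rule measure_eqI)
  fix B assume "B \<in> sets (distr (density X f) Y T)"
  then have B: "B \<in> sets Y" by simp
  \<comment> \<open>The hypothesis measures forward images, whereas \<open>distr\<close> measures
    preimages. Surjectivity of \<open>T\<close> reconciles them: \<open>B\<close> is the image of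
    its own preimage \<open>?C\<close>.\<close>
  let ?C = "T -` B \<inter> space X"
  have C: "?C \<in> sets X" using T B by (rule measurable_sets)
  have "T ` ?C = B"
    using bij sets.sets_into_space[OF B] by (force simp: bij_betw_def)
  then have "emeasure Y B = (\<integral>\<^sup>+ x\<in>?C. f x \<partial>X)"
    using image[OF C] by simp
  also have "\<dots> = emeasure (distr (density X f) Y T) B"
    using T B C f by (simp add: emeasure_distr emeasure_density)
  finally show "emeasure (distr (density X f) Y T) B = emeasure Y B" by simp
qed simp

text \<open>Substitution rule: \<open>Y\<close> is the push-forward under \<open>T\<close> of
  \<open>X\<close> with density \<open>f\<close>, so \<open>f\<close> acts as the Jacobian
  factor.\<close>

lemma nn_integral_image_density:
  assumes T: "T \<in> measurable X Y" and bij: "bij_betw T (space X) (space Y)"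
    and f: "f \<in> borel_measurable X"
    and image: "\<And>C. C \<in> sets X \<Longrightarrow> emeasure Y (T ` C) = (\<integral>\<^sup>+ x\<in>C. f x \<partial>X)"
    and h: "h \<in> borel_measurable Y"
  shows "(\<integral>\<^sup>+ y. h y \<partial>Y) = (\<integral>\<^sup>+ x. f x * h (T x) \<partial>X)"
proof -
  have "(\<integral>\<^sup>+ y. h y \<partial>Y) = (\<integral>\<^sup>+ y. h y \<partial>distr (density X f) Y T)"
    by (simp add: distr_density_image_measure[OF T bij f image])
  also have "\<dots> = (\<integral>\<^sup>+ x. f x * h (T x) \<partial>X)"
    using T h f measurable_compose[OF T h] by (simp add: nn_integral_distr nn_integral_density)
  finally show ?thesis .
qed

text \<open>Measuring \<open>C\<close> through \<open>T'\<close> and then substituting along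
  \<open>T\<close> returns the measure of \<open>C\<close>, now as the integral of the product of
  the two Jacobian factors. That product and the constant 1 are thus densities of the same measure,
  and sigma-finiteness of \<open>X\<close> makes such densities agree almost everywhere.\<close>

lemma AE_image_density_inverse:
  assumes "sigma_finite_measure X"
    and T: "T \<in> measurable X Y" and T': "T' \<in> measurable Y X"
    and bij: "bij_betw T (space X) (space Y)"
    and inv: "\<And>x. x \<in> space X \<Longrightarrow> T' (T x) = x"
    and f: "f \<in> borel_measurable X" and f': "f' \<in> borel_measurable Y"
    and image: "\<And>C. C \<in> sets X \<Longrightarrow> emeasure Y (T ` C) = (\<integral>\<^sup>+ x\<in>C. f x \<partial>X)"
    and image': "\<And>C. C \<in> sets Y \<Longrightarrow> emeasure X (T' ` C) = (\<integral>\<^sup>+ y\<in>C. f' y \<partial>Y)"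
  shows "AE x in X. f x * f' (T x) = 1"
proof -
  interpret sigma_finite_measure X by fact
  show ?thesis
  proof (rule density_unique2)
    show "(\<lambda>x. f x * f' (T x)) \<in> borel_measurable X"
      using f measurable_compose[OF T f'] by (rule borel_measurable_times_ennreal)
    fix C assume C: "C \<in> sets X"
    let ?E = "T' -` C \<inter> space Y"
    have E: "?E \<in> sets Y" using T' C by (rule measurable_sets)
    have "T' ` ?E = C"
    proof
      show "C \<subseteq> T' ` ?E"
      proof
        fix x assume x: "x \<in> C"
        then have "x \<in> space X" using sets.sets_into_space[OF C] by auto
        with x show "x \<in> T' ` ?E"
          using inv measurable_space[OF T] by (intro image_eqI[of _ _ "T x"]) auto
      qed
    qed auto
    then have "emeasure X C = (\<integral>\<^sup>+ y\<in>?E. f' y \<partial>Y)"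
      using image'[OF E] by simp
    also have "\<dots> = (\<integral>\<^sup>+ x. f x * (f' (T x) * indicator ?E (T x)) \<partial>X)"
      using E f' by (intro nn_integral_image_density[OF T bij f image]) auto
    \<comment> \<open>On the space of \<open>X\<close>, the point \<open>T x\<close> lies in
      \<open>?E\<close> exactly when \<open>x\<close> lies in \<open>C\<close>, because
      \<open>T'\<close> undoes \<open>T\<close>.\<close>
    also have "\<dots> = (\<integral>\<^sup>+ x\<in>C. (f x * f' (T x)) \<partial>X)"
      using inv measurable_space[OF T]
      by (intro nn_integral_cong) (auto simp: indicator_def)
    finally show "(\<integral>\<^sup>+ x\<in>C. (f x * f' (T x)) \<partial>X) = (\<integral>\<^sup>+ x\<in>C. 1 \<partial>X)"
      using C by simp
  qed simp
qed

lemma ennreal_mult_min: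
  fixes a b c :: ennreal
  shows "a * min b c = min (a * b) (a * c)"
  by (cases "b \<le> c") (auto simp: min_absorb1 min_absorb2 mult_left_mono)

text \<open>This is the core of reversibility. Substituting along \<open>T\<close> on the right
  produces a factor \<open>f x\<close>; moved inside the minimum it completes one argument to
  \<open>g' (T x) * f x\<close> and, since the Jacobian factors multiply to 1, reduces the other to
  \<open>g x\<close>. The arguments of the minimum have merely swapped places. The weight
  \<open>h\<close> will hold the indicators of the start and target sets.\<close>

lemma nn_integral_flow_reversible:
  fixes g :: "'a \<Rightarrow> ennreal" and g' :: "'b \<Rightarrow> ennreal"
  assumes X: "sigma_finite_measure X"
    and T: "T \<in> measurable X Y" and T': "T' \<in> measurable Y X"
    and bij: "bij_betw T (space X) (space Y)"
    and inv: "\<And>x. x \<in> space X \<Longrightarrow> T' (T x) = x"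
    and f: "f \<in> borel_measurable X" and f': "f' \<in> borel_measurable Y"
    and image: "\<And>C. C \<in> sets X \<Longrightarrow> emeasure Y (T ` C) = (\<integral>\<^sup>+ x\<in>C. f x \<partial>X)"
    and image': "\<And>C. C \<in> sets Y \<Longrightarrow> emeasure X (T' ` C) = (\<integral>\<^sup>+ y\<in>C. f' y \<partial>Y)"
    and h: "h \<in> borel_measurable X"
    and g: "g \<in> borel_measurable X" and g': "g' \<in> borel_measurable Y"
  shows "(\<integral>\<^sup>+ x. h x * min (g x) (g' (T x) * f x) \<partial>X)
       = (\<integral>\<^sup>+ y. h (T' y) * min (g' y) (g (T' y) * f' y) \<partial>Y)"
proof -
  note [measurable] = T T' f f' h g g'
  have "(\<integral>\<^sup>+ y. h (T' y) * min (g' y) (g (T' y) * f' y) \<partial>Y)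
      = (\<integral>\<^sup>+ x. f x * (h (T' (T x)) * min (g' (T x)) (g (T' (T x)) * f' (T x))) \<partial>X)"
    by (intro nn_integral_image_density[OF T bij f image]) auto
  also have "\<dots> = (\<integral>\<^sup>+ x. h x * min (g x) (g' (T x) * f x) \<partial>X)"
  proof (rule nn_integral_cong_AE)
    have "AE x in X. f x * f' (T x) = 1"
      by (rule AE_image_density_inverse[OF X T T' bij inv f f' image image'])
    then show "AE x in X. f x * (h (T' (T x)) * min (g' (T x)) (g (T' (T x)) * f' (T x)))
        = h x * min (g x) (g' (T x) * f x)"
      using AE_space
    proof eventually_elim
      case (elim x)
      have "f x * (h (T' (T x)) * min (g' (T x)) (g (T' (T x)) * f' (T x)))
          = h x * (f x * min (g' (T x)) (g x * f' (T x)))"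
        using elim(2) by (simp add: inv ac_simps)
      \<comment> \<open>The Jacobian factor enters the minimum here; its product with
        \<open>f' (T x)\<close> is then replaced by 1.\<close>
      also have "f x * min (g' (T x)) (g x * f' (T x)) = min (g' (T x) * f x) (g x * (f x * f' (T x)))"
        by (simp add: ennreal_mult_min ac_simps)
      finally show ?case by (simp add: elim(1) min.commute)
    qed
  qed
  finally show ?thesis by simp
qed

section \<open>The transition kernel as a measure\<close>

lemma sets_transition_kernel [simp]:
  "sets (transition_kernel \<Lambda> M N \<nu> q k sm a s) = sets \<Lambda>"
  unfolding transition_kernel_def by (simp add: sets.sigma_sets_eq sets.space_closed)

lemma space_transition_kernel [simp]:
  "space (transition_kernel \<Lambda> M N \<nu> q k sm a s) = space \<Lambda>"
  by (rule sets_eq_imp_space_eq) simp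

text \<open>\<open>measure_of\<close> takes the prescribed values only once the set function is
  known to be countably additive. Dirac measures are, and the countable sum over sets passes through
  the integral over \<open>u\<close> and the sum over moves. Measurability is required only of moves
  starting in a component that contains \<open>s\<close>, since all others contribute 0.\<close>

lemma emeasure_transition_kernel:
  assumes sm: "\<And>l. l \<in> M \<Longrightarrow> s \<in> space (N l) \<Longrightarrow> (\<lambda>u. sm l (s, u)) \<in> measurable (\<nu> l) \<Lambda>"
    and a: "\<And>l. l \<in> M \<Longrightarrow> s \<in> space (N l) \<Longrightarrow> a l s \<in> borel_measurable (\<nu> l)"
    and k: "\<And>l. l \<in> M \<Longrightarrow> s \<in> space (N l) \<Longrightarrow> (\<lambda>u. k l (s, u)) \<in> borel_measurable (\<nu> l)"
    and B: "B \<in> sets \<Lambda>"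
  shows "emeasure (transition_kernel \<Lambda> M N \<nu> q k sm a s) B = (\<integral>\<^sup>+ l.
       (if s \<in> space (N l)
        then ennreal (q l s) *
          (\<integral>\<^sup>+ u. (ennreal (a l s u) * indicator B (sm l (s, u)) + ennreal (1 - a l s u) * indicator B s)
               * ennreal (k l (s, u)) \<partial>\<nu> l)
        else 0) \<partial>count_space M)"
proof -
  \<comment> \<open>\<open>G\<close> is the integrand of one move and \<open>F\<close> the
    contribution of that move, both as functions of the target set, so that additivity can be
    checked move by move.\<close>
  define G where "G = (\<lambda>B l u. (ennreal (a l s u) * emeasure (return \<Lambda> (sm l (s, u))) B
                + ennreal (1 - a l s u) * emeasure (return \<Lambda> s) B) * ennreal (k l (s, u)))"
  define F where "F B l = (if s \<in> space (N l) then ennreal (q l s) * (\<integral>\<^sup>+ u. G B l u \<partial>\<nu> l) else 0)" for B l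
  have G_sums: "(\<Sum>n. F (A n) l) = F (\<Union>n. A n) l"
    if A: "range A \<subseteq> sets \<Lambda>" "disjoint_family A" and l: "l \<in> M" for A l
  proof (cases "s \<in> space (N l)")
    case True
    note [measurable] = sm[OF l True] a[OF l True] k[OF l True]
    have [measurable]: "A n \<in> sets \<Lambda>" for n using A by auto
    have [measurable]: "G (A n) l \<in> borel_measurable (\<nu> l)" for n
      unfolding G_def by (simp add: emeasure_return)
    have sums: "(\<Sum>n. emeasure (return \<Lambda> x) (A n)) = emeasure (return \<Lambda> x) (\<Union>n. A n)" for x
      using A by (intro suminf_emeasure) auto
    have "(\<Sum>n. G (A n) l u) = G (\<Union>n. A n) l u" for u
      unfolding G_def by (simp add: sums distrib_right mult.assoc del: emeasure_return
          flip: suminf_add sums)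
    moreover have "(\<Sum>n. \<integral>\<^sup>+ u. G (A n) l u \<partial>\<nu> l) = (\<integral>\<^sup>+ u. (\<Sum>n. G (A n) l u) \<partial>\<nu> l)"
      by (rule nn_integral_suminf[symmetric]) simp
    ultimately show ?thesis
      using True by (simp add: F_def)
  qed (simp add: F_def)
  have "emeasure (transition_kernel \<Lambda> M N \<nu> q k sm a s) B = (\<integral>\<^sup>+ l. F B l \<partial>count_space M)"
  proof (rule emeasure_measure_of)
    show "transition_kernel \<Lambda> M N \<nu> q k sm a s
        = measure_of (space \<Lambda>) (sets \<Lambda>) (\<lambda>B. \<integral>\<^sup>+ l. F B l \<partial>count_space M)"
      unfolding transition_kernel_def F_def G_def ..
    show "sets \<Lambda> \<subseteq> Pow (space \<Lambda>)" by (rule sets.space_closed)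
    show "B \<in> sets (transition_kernel \<Lambda> M N \<nu> q k sm a s)" using B by simp
    show "positive (sets (transition_kernel \<Lambda> M N \<nu> q k sm a s)) (\<lambda>B. \<integral>\<^sup>+ l. F B l \<partial>count_space M)"
      by (simp add: positive_def F_def G_def if_distrib cong: if_cong)
    show "countably_additive (sets (transition_kernel \<Lambda> M N \<nu> q k sm a s))
        (\<lambda>B. \<integral>\<^sup>+ l. F B l \<partial>count_space M)"
    proof (rule countably_additiveI)
      fix A :: "nat \<Rightarrow> _ set"
      assume A: "range A \<subseteq> sets (transition_kernel \<Lambda> M N \<nu> q k sm a s)" "disjoint_family A"
      have "(\<Sum>n. \<integral>\<^sup>+ l. F (A n) l \<partial>count_space M) = (\<integral>\<^sup>+ l. (\<Sum>n. F (A n) l) \<partial>count_space M)"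
        by (rule nn_integral_suminf[symmetric]) simp
      also have "\<dots> = (\<integral>\<^sup>+ l. F (\<Union>n. A n) l \<partial>count_space M)"
        using A by (intro nn_integral_cong G_sums) auto
      finally show "(\<Sum>n. \<integral>\<^sup>+ l. F (A n) l \<partial>count_space M) = (\<integral>\<^sup>+ l. F (\<Union>n. A n) l \<partial>count_space M)" .
    qed
  qed
  then show ?thesis
    unfolding F_def G_def using B by (simp cong: if_cong)
qed

section \<open>The acceptance probability\<close>

lemma acceptance_bounds:
  assumes "0 \<le> p s" "0 \<le> p (sm l (s, u))" "0 \<le> k l (s, u)" "0 \<le> k (r l) (move_map sm um l (s, u))"
    and "0 \<le> q l s" "0 \<le> q (r l) (sm l (s, u))" "0 \<le> f l (s, u)"
  shows "0 \<le> acceptance p q r k sm um f l s u \<and> acceptance p q r k sm um f l s u \<le> 1"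
  unfolding acceptance_def using assms by (auto intro!: mult_nonneg_nonneg divide_nonneg_nonneg)

text \<open>Where a denominator vanishes, both sides are 0.\<close>

lemma flow_times_acceptance:
  assumes "0 \<le> p s" "0 \<le> p (sm l (s, u))" "0 \<le> k l (s, u)" "0 \<le> k (r l) (move_map sm um l (s, u))"
    and "0 \<le> q l s" "0 \<le> q (r l) (sm l (s, u))" "0 \<le> f l (s, u)"
  shows "p s * q l s * k l (s, u) * acceptance p q r k sm um f l s u
       = min (p s * q l s * k l (s, u))
             (p (sm l (s, u)) * q (r l) (sm l (s, u)) * k (r l) (move_map sm um l (s, u)) * f l (s, u))"
proof (cases "p s * k l (s, u) = 0 \<or> q l s = 0")
  case True
  moreover have "0 \<le> p (sm l (s, u)) * q (r l) (sm l (s, u))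
      * k (r l) (move_map sm um l (s, u)) * f l (s, u)"
    using assms by simp
  ultimately show ?thesis by (auto simp: acceptance_def)
next
  case False
  \<comment> \<open>\<open>c\<close> is the density of the proposed mass and \<open>b\<close> the
    ratio inside the acceptance probability. Multiplying the minimum by the nonnegative
    \<open>c\<close> clears all denominators of \<open>b\<close>.\<close>
  define c where "c = p s * q l s * k l (s, u)"
  define b where "b = p (sm l (s, u)) * k (r l) (move_map sm um l (s, u)) / (p s * k l (s, u))
      * (q (r l) (sm l (s, u)) / q l s) * f l (s, u)"
  have "0 \<le> c"
    using assms by (simp add: c_def)
  then have "c * min 1 b = min c (c * b)"
    by (simp add: min_mult_distrib_left)
  moreover have "acceptance p q r k sm um f l s u = min 1 b"
    unfolding acceptance_def b_def if_not_P[OF False] ..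
  moreover have "c * b = p (sm l (s, u)) * q (r l) (sm l (s, u))
      * k (r l) (move_map sm um l (s, u)) * f l (s, u)"
    using False by (simp add: c_def b_def)
  ultimately show ?thesis
    by (simp add: c_def)
qed

section \<open>The setting: hypotheses, notation and regularity of the moves\<close>

locale posthoc_translations =
  fixes D :: "'d set"
    and lam :: "'d \<Rightarrow> 's measure"
    and P :: "'s measure"
    and p :: "'s \<Rightarrow> real"
    and M :: "'l set"
    and r :: "'l \<Rightarrow> 'l"
    and src tgt :: "'l \<Rightarrow> 'd"
    and q :: "'l \<Rightarrow> 's \<Rightarrow> real"
    and \<nu> :: "'l \<Rightarrow> 'u measure"
    and k :: "'l \<Rightarrow> 's \<times> 'u \<Rightarrow> real"
    and sm :: "'l \<Rightarrow> 's \<times> 'u \<Rightarrow> 's"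
    and um :: "'l \<Rightarrow> 's \<times> 'u \<Rightarrow> 'u"
    and f :: "'l \<Rightarrow> 's \<times> 'u \<Rightarrow> real"
  assumes D_countable: "countable D"
    and lam_sigma_finite: "\<And>i. i \<in> D \<Longrightarrow> sigma_finite_measure (lam i)"
    and lam_disjoint: "disjoint_family_on (\<lambda>i. space (lam i)) D"
    and P_prob: "prob_space P"
    and p_measurable: "p \<in> borel_measurable (mixture_measure D lam)"
    and p_nonneg: "\<And>s. s \<in> space (mixture_measure D lam) \<Longrightarrow> 0 \<le> p s"
    and P_density: "P = density (mixture_measure D lam) (\<lambda>s. ennreal (p s))"
    and M_countable: "countable M"
    and r_bij: "bij_betw r M M"
    and r_invol: "\<And>l. l \<in> M \<Longrightarrow> r (r l) = l"
    and src_in: "\<And>l. l \<in> M \<Longrightarrow> src l \<in> D"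
    and tgt_in: "\<And>l. l \<in> M \<Longrightarrow> tgt l \<in> D"
    and src_backward: "\<And>l. l \<in> M \<Longrightarrow> src (r l) = tgt l"
    and tgt_backward: "\<And>l. l \<in> M \<Longrightarrow> tgt (r l) = src l"
    and q_measurable: "\<And>l. l \<in> M \<Longrightarrow> q l \<in> borel_measurable (mixture_measure D lam)"
    and q_range: "\<And>l s. l \<in> M \<Longrightarrow> s \<in> space (mixture_measure D lam) \<Longrightarrow> q l s \<in> {0..1}"
    and q_sum: "\<And>s. s \<in> space (mixture_measure D lam) \<Longrightarrow> ((\<lambda>l. q l s) has_sum 1) M"
    and q_zero: "\<And>l s. l \<in> M \<Longrightarrow> s \<in> space (mixture_measure D lam) \<Longrightarrow>
                   s \<notin> space (lam (src l)) \<Longrightarrow> q l s = 0"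
    and \<nu>_sigma_finite: "\<And>l. l \<in> M \<Longrightarrow> sigma_finite_measure (\<nu> l)"
    and k_density: "\<And>l. l \<in> M \<Longrightarrow> kernel_density (lam (src l)) (\<nu> l) (k l)"
    and sm_measurable: "\<And>l. l \<in> M \<Longrightarrow>
          sm l \<in> measurable (lam (src l) \<Otimes>\<^sub>M \<nu> l) (lam (tgt l))"
    and um_measurable: "\<And>l. l \<in> M \<Longrightarrow>
          um l \<in> measurable (lam (src l) \<Otimes>\<^sub>M \<nu> l) (\<nu> (r l))"
    and f_measurable: "\<And>l. l \<in> M \<Longrightarrow> f l \<in> borel_measurable (lam (src l) \<Otimes>\<^sub>M \<nu> l)"
    and f_nonneg: "\<And>l x. l \<in> M \<Longrightarrow> x \<in> space (lam (src l) \<Otimes>\<^sub>M \<nu> l) \<Longrightarrow> 0 \<le> f l x"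
    and map_bij: "\<And>l. l \<in> M \<Longrightarrow>
          bij_betw (move_map sm um l) (space (lam (src l) \<Otimes>\<^sub>M \<nu> l))
            (space (lam (tgt l) \<Otimes>\<^sub>M \<nu> (r l)))"
    and map_inverse: "\<And>l x. l \<in> M \<Longrightarrow> x \<in> space (lam (src l) \<Otimes>\<^sub>M \<nu> l) \<Longrightarrow>
          move_map sm um (r l) (move_map sm um l x) = x"
    and map_image_measure: "\<And>l C. l \<in> M \<Longrightarrow> C \<in> sets (lam (src l) \<Otimes>\<^sub>M \<nu> l) \<Longrightarrow>
          emeasure (lam (tgt l) \<Otimes>\<^sub>M \<nu> (r l)) (move_map sm um l ` C)
            = (\<integral>\<^sup>+ x\<in>C. ennreal (f l x) \<partial>(lam (src l) \<Otimes>\<^sub>M \<nu> l))"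
begin

definition \<Lambda> :: "'s measure" where "\<Lambda> = mixture_measure D lam"

definition S :: "'l \<Rightarrow> 's measure" where "S l = lam (src l)"

definition X :: "'l \<Rightarrow> ('s \<times> 'u) measure" where "X l = S l \<Otimes>\<^sub>M \<nu> l"

definition T :: "'l \<Rightarrow> 's \<times> 'u \<Rightarrow> 's \<times> 'u" where "T l = move_map sm um l"

definition a :: "'l \<Rightarrow> 's \<Rightarrow> 'u \<Rightarrow> real" where "a = acceptance p q r k sm um f"

definition \<mu> :: "'s \<Rightarrow> 's measure" where "\<mu> = transition_kernel \<Lambda> M S \<nu> q k sm a"

text \<open>Contribution of a move to the mass of \<open>B\<close> as one function on the product
  space, with the move probability already under the integral over \<open>u\<close>, ready for
  Tonelli.\<close>

definition G :: "'s set \<Rightarrow> 'l \<Rightarrow> 's \<times> 'u \<Rightarrow> ennreal" where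
  "G = (\<lambda>B l x. ennreal (q l (fst x)) * ((ennreal (a l (fst x) (snd x)) * indicator B (sm l x)
      + ennreal (1 - a l (fst x) (snd x)) * indicator B (fst x)) * ennreal (k l x)))"

definition g :: "'l \<Rightarrow> 's \<times> 'u \<Rightarrow> real" where
  "g = (\<lambda>l x. p (fst x) * q l (fst x) * k l x)"

text \<open>The mass that move \<open>l\<close> proposes from \<open>A\<close> into \<open>B\<close>
  and accepts. The minimum replaces the acceptance probability: it has no denominators and is the
  form in which the forward and backward moves are symmetric.\<close>

definition flow :: "'s set \<Rightarrow> 's set \<Rightarrow> 'l \<Rightarrow> ennreal" where
  "flow = (\<lambda>A B l. \<integral>\<^sup>+ x. (indicator A (fst x) * indicator B (sm l x)) *
      min (ennreal (g l x)) (ennreal (g (r l) (T l x)) * ennreal (f l x)) \<partial>X l)"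

text \<open>The rejected mass of move \<open>l\<close>; start and end coincide, so both indicators
  are evaluated at the same state.\<close>

definition stay :: "'s set \<Rightarrow> 's set \<Rightarrow> 'l \<Rightarrow> ennreal" where
  "stay = (\<lambda>A B l. \<integral>\<^sup>+ x. indicator A (fst x) * indicator B (fst x) *
      (ennreal (g l x) * ennreal (1 - a l (fst x) (snd x))) \<partial>X l)"

lemma r_closed:
  assumes "l \<in> M"
  shows "r l \<in> M"
  using r_bij assms by (auto simp: bij_betw_def)

lemma restrict_space_S:
  assumes "l \<in> M"
  shows "restrict_space \<Lambda> (space (S l)) = S l"
  unfolding \<Lambda>_def S_def using lam_disjoint src_in[OF assms] by (rule restrict_space_mixture_measure)

lemma space_S_sets:
  assumes "l \<in> M"
  shows "space (S l) \<in> sets \<Lambda>"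
  unfolding \<Lambda>_def S_def using src_in[OF assms] by (rule space_component_in_sets_mixture_measure)

lemma space_S_Int_sets:
  assumes "l \<in> M"
  shows "space (S l) \<inter> space \<Lambda> \<in> sets \<Lambda>"
  using space_S_sets[OF assms] by auto

lemma space_S_subset:
  assumes "l \<in> M" "s \<in> space (S l)"
  shows "s \<in> space \<Lambda>"
  using sets.sets_into_space[OF space_S_sets[OF assms(1)]] assms(2) by auto

lemma measurable_restrict_S:
  assumes "h \<in> measurable \<Lambda> K" "l \<in> M"
  shows "h \<in> measurable (S l) K"
  using measurable_restrict_space1[OF assms(1), of "space (S l)"] restrict_space_S[OF assms(2)] by simp

lemma measurable_inclusion:
  assumes "l \<in> M"
  shows "(\<lambda>x. x) \<in> measurable (S l) \<Lambda>"
  using assms by (intro measurable_restrict_S) auto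

text \<open>The hypotheses name the codomain of a move by \<open>tgt\<close>, whereas
  \<open>X\<close> is built from \<open>src\<close>. Identifying the two lets \<open>T l\<close> be
  treated as a map from \<open>X l\<close> to \<open>X (r l)\<close>.\<close>

lemma X_backward:
  assumes "l \<in> M"
  shows "X (r l) = lam (tgt l) \<Otimes>\<^sub>M \<nu> (r l)"
  by (simp add: X_def S_def src_backward[OF assms])

lemma space_X_iff:
  shows "(s, u) \<in> space (X l) \<longleftrightarrow> s \<in> space (S l) \<and> u \<in> space (\<nu> l)"
  by (auto simp: X_def space_pair_measure)

lemma sigma_finite_X:
  assumes "l \<in> M"
  shows "sigma_finite_measure (X l)"
proof -
  interpret pair_sigma_finite "S l" "\<nu> l"
    unfolding S_def using assms by (intro pair_sigma_finite.intro lam_sigma_finite \<nu>_sigma_finite src_in)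
  show ?thesis unfolding X_def by unfold_locales
qed

lemma measurable_T:
  assumes l: "l \<in> M"
  shows "T l \<in> measurable (X l) (X (r l))"
  unfolding T_def X_backward[OF l] move_map_def[abs_def] using sm_measurable[OF l] um_measurable[OF l]
  by (auto simp: X_def S_def)

lemma measurable_sm_S:
  assumes l: "l \<in> M"
  shows "sm l \<in> measurable (X l) (S (r l))"
  using sm_measurable[OF l] by (simp add: X_def S_def src_backward[OF l])

lemma measurable_sm:
  assumes l: "l \<in> M"
  shows "sm l \<in> measurable (X l) \<Lambda>"
  using measurable_compose[OF measurable_sm_S[OF l] measurable_inclusion[OF r_closed[OF l]]] .

lemma measurable_fst_S:
  shows "fst \<in> measurable (X l) (S l)"
  unfolding X_def by simp

lemma measurable_fst_X:
  assumes l: "l \<in> M"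
  shows "fst \<in> measurable (X l) \<Lambda>"
  using measurable_compose[OF measurable_fst_S measurable_inclusion[OF l]] .

lemma bij_betw_T:
  assumes l: "l \<in> M"
  shows "bij_betw (T l) (space (X l)) (space (X (r l)))"
  using map_bij[OF l] unfolding X_backward[OF l] unfolding T_def X_def S_def .

lemma T_inverse:
  assumes "l \<in> M" "x \<in> space (X l)"
  shows "T (r l) (T l x) = x"
  using map_inverse assms by (simp add: T_def X_def S_def)

lemma emeasure_T_image:
  assumes l: "l \<in> M" and C: "C \<in> sets (X l)"
  shows "emeasure (X (r l)) (T l ` C) = (\<integral>\<^sup>+ x\<in>C. ennreal (f l x) \<partial>X l)"
  using map_image_measure[OF l] C unfolding X_backward[OF l] unfolding T_def X_def S_def by blast

lemma measurable_f:
  assumes "l \<in> M"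
  shows "f l \<in> borel_measurable (X l)"
  using f_measurable assms by (simp add: X_def S_def)

lemma measurable_k:
  assumes "l \<in> M"
  shows "k l \<in> borel_measurable (X l)"
  using k_density[OF assms] by (simp add: kernel_density_def X_def S_def)

lemma measurable_p:
  shows "p \<in> borel_measurable \<Lambda>"
  using p_measurable by (simp add: \<Lambda>_def)

lemma measurable_q:
  assumes "l \<in> M"
  shows "q l \<in> borel_measurable \<Lambda>"
  using q_measurable assms by (simp add: \<Lambda>_def)

lemma p_ge_0:
  assumes "s \<in> space \<Lambda>"
  shows "0 \<le> p s"
  using p_nonneg assms by (simp add: \<Lambda>_def)

lemma q_ge_0:
  assumes "l \<in> M" "s \<in> space \<Lambda>"
  shows "0 \<le> q l s"
  using q_range assms by (simp add: \<Lambda>_def)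

lemma k_ge_0:
  assumes "l \<in> M" "x \<in> space (X l)"
  shows "0 \<le> k l x"
  using k_density assms by (simp add: kernel_density_def X_def S_def)

lemma f_ge_0:
  assumes "l \<in> M" "x \<in> space (X l)"
  shows "0 \<le> f l x"
  using f_nonneg assms by (simp add: X_def S_def)

lemma nn_integral_k:
  assumes "l \<in> M" "s \<in> space (S l)"
  shows "(\<integral>\<^sup>+ u. ennreal (k l (s, u)) \<partial>\<nu> l) = 1"
  using k_density assms by (simp add: kernel_density_def S_def)

text \<open>Nonnegativity is assumed only on the respective spaces. It applies at the proposed point
  because \<open>sm l\<close> stays in the state space and \<open>T l\<close> maps into the space of
  the backward move.\<close>

lemma all_nonneg:
  assumes l: "l \<in> M" and x: "(s, u) \<in> space (X l)"
  shows "0 \<le> p s" "0 \<le> p (sm l (s, u))" "0 \<le> k l (s, u)" "0 \<le> k (r l) (move_map sm um l (s, u))"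
      "0 \<le> q l s" "0 \<le> q (r l) (sm l (s, u))" "0 \<le> f l (s, u)"
  using p_ge_0 q_ge_0 k_ge_0[OF l x] f_ge_0[OF l x] measurable_space[OF measurable_sm[OF l] x] r_closed[OF l] l
    k_ge_0[OF r_closed[OF l] measurable_space[OF measurable_T[OF l] x]] space_S_subset[OF l, of s] x
  by (auto simp: T_def space_X_iff)

lemma a_bounds:
  assumes "l \<in> M" "(s, u) \<in> space (X l)"
  shows "0 \<le> a l s u" "a l s u \<le> 1"
  using acceptance_bounds[where p = p and q = q and r = r and k = k and sm = sm and um = um and f = f,
      OF all_nonneg[OF assms]] by (simp_all add: a_def)

lemma measurable_a:
  assumes l: "l \<in> M"
  shows "(\<lambda>x. a l (fst x) (snd x)) \<in> borel_measurable (X l)"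
proof -
  note [measurable] = measurable_compose[OF measurable_fst_X[OF l] measurable_p] measurable_compose[OF measurable_sm[OF l] measurable_p]
    measurable_compose[OF measurable_fst_X[OF l] measurable_q[OF l]] measurable_compose[OF measurable_sm[OF l] measurable_q[OF r_closed[OF l]]]
    measurable_compose[OF measurable_T[OF l] measurable_k[OF r_closed[OF l]], unfolded T_def] measurable_k[OF l] measurable_f[OF l]
  show ?thesis
    unfolding a_def acceptance_def prod.collapse by measurable
qed

lemma measurable_Pair_X:
  assumes "s \<in> space (S l)"
  shows "Pair s \<in> measurable (\<nu> l) (X l)"
  using assms by (simp add: X_def)

section \<open>The kernel is a Markov kernel\<close>

lemma emeasure_\<mu>:
  assumes B: "B \<in> sets \<Lambda>"
  shows "emeasure (\<mu> s) B = (\<integral>\<^sup>+ l.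
       (if s \<in> space (S l)
        then ennreal (q l s) *
          (\<integral>\<^sup>+ u. (ennreal (a l s u) * indicator B (sm l (s, u)) + ennreal (1 - a l s u) * indicator B s)
               * ennreal (k l (s, u)) \<partial>\<nu> l)
        else 0) \<partial>count_space M)"
  unfolding \<mu>_def
proof (rule emeasure_transition_kernel[OF _ _ _ B])
  fix l assume "l \<in> M" "s \<in> space (S l)"
  note l = this
  show "(\<lambda>u. sm l (s, u)) \<in> measurable (\<nu> l) \<Lambda>"
    using measurable_compose[OF measurable_Pair_X[OF l(2)] measurable_sm[OF l(1)]] .
  show "(\<lambda>u. k l (s, u)) \<in> borel_measurable (\<nu> l)"
    using measurable_compose[OF measurable_Pair_X[OF l(2)] measurable_k[OF l(1)]] .
  show "a l s \<in> borel_measurable (\<nu> l)"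
    using measurable_compose[OF measurable_Pair_X[OF l(2)] measurable_a[OF l(1)]] by simp
qed

lemma measurable_G:
  assumes l: "l \<in> M" and B: "B \<in> sets \<Lambda>"
  shows "G B l \<in> borel_measurable (X l)"
proof -
  note [measurable] = measurable_sm[OF l] measurable_fst_X[OF l] measurable_a[OF l] measurable_k[OF l] B
    measurable_compose[OF measurable_fst_X[OF l] measurable_q[OF l]]
  show ?thesis unfolding G_def by measurable
qed

lemma emeasure_\<mu>_G:
  assumes B: "B \<in> sets \<Lambda>"
  shows "emeasure (\<mu> s) B =
      (\<integral>\<^sup>+ l. (if s \<in> space (S l) then \<integral>\<^sup>+ u. G B l (s, u) \<partial>\<nu> l else 0) \<partial>count_space M)"
  unfolding emeasure_\<mu>[OF B]
proof (intro nn_integral_cong if_cong refl)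
  fix l assume "l \<in> space (count_space M)" and s: "s \<in> space (S l)"
  then have l: "l \<in> M" by simp
  note [measurable] = measurable_compose[OF measurable_Pair_X[OF s] measurable_sm[OF l]]
    measurable_compose[OF measurable_Pair_X[OF s] measurable_k[OF l]]
    measurable_compose[OF measurable_Pair_X[OF s] measurable_a[OF l], simplified] B
  show "ennreal (q l s) *
        (\<integral>\<^sup>+ u. (ennreal (a l s u) * indicator B (sm l (s, u)) + ennreal (1 - a l s u) * indicator B s)
             * ennreal (k l (s, u)) \<partial>\<nu> l) = (\<integral>\<^sup>+ u. G B l (s, u) \<partial>\<nu> l)"
    unfolding G_def fst_conv snd_conv by (rule nn_integral_cmult[symmetric]) measurable
qed

lemma measurable_nn_integral_G:
  assumes l: "l \<in> M" and B: "B \<in> sets \<Lambda>"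
  shows "(\<lambda>s. \<integral>\<^sup>+ u. G B l (s, u) \<partial>\<nu> l) \<in> borel_measurable (S l)"
  using sigma_finite_measure.borel_measurable_nn_integral_fst[OF \<nu>_sigma_finite[OF l] measurable_G[OF l B, unfolded X_def]] .

text \<open>The source component is a measurable set on which the mixture restricts to
  \<open>S l\<close>, so a function measurable there remains measurable when extended by 0.\<close>

lemma measurable_move_term:
  assumes l: "l \<in> M" and B: "B \<in> sets \<Lambda>"
  shows "(\<lambda>s. if s \<in> space (S l) then \<integral>\<^sup>+ u. G B l (s, u) \<partial>\<nu> l else 0) \<in> borel_measurable \<Lambda>"
  using measurable_nn_integral_G[OF l B] by (subst measurable_restrict_space_iff[OF space_S_Int_sets[OF l], symmetric]) (simp_all add: restrict_space_S[OF l])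

lemma measurable_emeasure_\<mu>:
  assumes B: "B \<in> sets \<Lambda>"
  shows "(\<lambda>s. emeasure (\<mu> s) B) \<in> borel_measurable \<Lambda>"
  unfolding emeasure_\<mu>_G[OF B] using M_countable measurable_move_term[OF _ B]
  by (rule borel_measurable_nn_integral_count_space)

text \<open>Acceptance and rejection together keep the whole proposal mass 1 of a move, so the total
  mass is the sum of the move probabilities.\<close>

lemma prob_space_\<mu>:
  assumes s: "s \<in> space \<Lambda>"
  shows "prob_space (\<mu> s)"
proof
  have "emeasure (\<mu> s) (space (\<mu> s)) = emeasure (\<mu> s) (space \<Lambda>)"
    by (simp add: \<mu>_def)
  also have "\<dots> = (\<integral>\<^sup>+ l. ennreal (q l s) \<partial>count_space M)"
    unfolding emeasure_\<mu>[OF sets.top]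
  proof (rule nn_integral_cong)
    fix l assume "l \<in> space (count_space M)"
    then have l: "l \<in> M" by simp
    show "(if s \<in> space (S l) then ennreal (q l s) *
        (\<integral>\<^sup>+ u. (ennreal (a l s u) * indicator (space \<Lambda>) (sm l (s, u))
             + ennreal (1 - a l s u) * indicator (space \<Lambda>) s) * ennreal (k l (s, u)) \<partial>\<nu> l)
      else 0) = ennreal (q l s)"
    proof (cases "s \<in> space (S l)")
      case True
      have "(\<integral>\<^sup>+ u. (ennreal (a l s u) * indicator (space \<Lambda>) (sm l (s, u))
             + ennreal (1 - a l s u) * indicator (space \<Lambda>) s) * ennreal (k l (s, u)) \<partial>\<nu> l)
          = (\<integral>\<^sup>+ u. ennreal (k l (s, u)) \<partial>\<nu> l)"
      proof (rule nn_integral_cong)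
        fix u assume "u \<in> space (\<nu> l)"
        then have x: "(s, u) \<in> space (X l)" using True by (simp add: space_X_iff)
        \<comment> \<open>Both bounds on the acceptance probability matter: \<open>ennreal\<close>
          truncates negative reals to 0.\<close>
        have "ennreal (a l s u) + ennreal (1 - a l s u) = 1"
          using a_bounds[OF l x] by (simp flip: ennreal_plus)
        then show "(ennreal (a l s u) * indicator (space \<Lambda>) (sm l (s, u))
             + ennreal (1 - a l s u) * indicator (space \<Lambda>) s) * ennreal (k l (s, u)) = ennreal (k l (s, u))"
          using s measurable_space[OF measurable_sm[OF l] x] by simp
      qed
      then show ?thesis
        using True nn_integral_k[OF l] by simp
    next
      \<comment> \<open>The kernel omits this move at \<open>s\<close>; its probability there is 0
        as well, so the sum is unaffected.\<close>
      case False
      then show ?thesis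
        using q_zero[OF l] s by (simp add: \<Lambda>_def S_def)
    qed
  qed
  also have "\<dots> = ennreal 1"
    using q_sum s q_ge_0 by (intro has_sum_imp_nn_integral_count_space) (auto simp: \<Lambda>_def)
  finally show "emeasure (\<mu> s) (space (\<mu> s)) = 1" by simp
qed

lemma markov_kernel_\<mu>:
  shows "markov_kernel \<Lambda> \<mu>"
  unfolding markov_kernel_def
proof (intro measurable_prob_algebraI measurable_subprob_algebra)
  show "subprob_space (\<mu> s)" if "s \<in> space \<Lambda>" for s
    using prob_space_\<mu>[OF that] by (rule prob_space_imp_subprob_space)
qed (simp_all add: prob_space_\<mu> measurable_emeasure_\<mu>, simp add: \<mu>_def)

section \<open>Accepted and rejected mass of a single move\<close>

lemma measurable_g:
  assumes l: "l \<in> M"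
  shows "g l \<in> borel_measurable (X l)"
proof -
  note [measurable] = measurable_compose[OF measurable_fst_X[OF l] measurable_p] measurable_k[OF l]
    measurable_compose[OF measurable_fst_X[OF l] measurable_q[OF l]]
  show ?thesis unfolding g_def by measurable
qed

lemma g_ge_0:
  assumes "l \<in> M" "x \<in> space (X l)"
  shows "0 \<le> g l x"
  using all_nonneg[OF assms(1), of "fst x" "snd x"] assms(2) by (simp add: g_def)

lemma stay_commute:
  shows "stay A B l = stay B A l"
  unfolding stay_def by (simp add: mult.commute[of "indicator A _"])

text \<open>The map of a move exchanges start and proposed state with those of its backward move.
  Reversing the flow with the two indicators as weight therefore swaps \<open>A\<close> and
  \<open>B\<close>.\<close>

lemma flow_backward:
  assumes l: "l \<in> M" and A: "A \<in> sets \<Lambda>" and B: "B \<in> sets \<Lambda>"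
  shows "flow A B l = flow B A (r l)"
proof -
  note rl = r_closed[OF l]
  have rr: "r (r l) = l" by (rule r_invol[OF l])
  have [measurable]: "sm l \<in> measurable (X l) \<Lambda>" "fst \<in> measurable (X l) \<Lambda>" "A \<in> sets \<Lambda>" "B \<in> sets \<Lambda>"
    using measurable_sm[OF l] measurable_fst_X[OF l] A B by auto
  have "flow A B l = (\<integral>\<^sup>+ y. (indicator A (fst (T (r l) y)) * indicator B (sm l (T (r l) y))) *
    min (ennreal (g (r l) y)) (ennreal (g l (T (r l) y)) * ennreal (f (r l) y)) \<partial>X (r l))"
    unfolding flow_def
    using measurable_T[OF l] measurable_T[OF rl] emeasure_T_image[OF rl] measurable_f[OF l] measurable_f[OF rl] measurable_g[OF l] measurable_g[OF rl] emeasure_T_image[OF l]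
    by (intro nn_integral_flow_reversible[OF sigma_finite_X[OF l] _ _ bij_betw_T[OF l] T_inverse[OF l]])
       (simp_all add: rr)
  also have "\<dots> = flow B A (r l)"
    unfolding flow_def rr
  proof (rule nn_integral_cong, rule arg_cong2[where f = "(*)", OF _ refl])
    \<comment> \<open>The start of the transported point is the proposal of \<open>r l\<close> from
      \<open>y\<close>. Its proposal under \<open>l\<close> is the start of \<open>y\<close>,
      because \<open>T l\<close> undoes \<open>T (r l)\<close>.\<close>
    fix y assume y: "y \<in> space (X (r l))"
    have "fst (T (r l) y) = sm (r l) y" by (simp add: T_def move_map_def)
    moreover have "sm l (T (r l) y) = fst (T l (T (r l) y))" by (simp add: T_def move_map_def)
    moreover have "T l (T (r l) y) = y" using T_inverse[OF rl y] by (simp add: rr)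
    ultimately show "indicator A (fst (T (r l) y)) * indicator B (sm l (T (r l) y))
        = (indicator B (fst y) * indicator A (sm (r l) y) :: ennreal)"
      by (simp add: mult.commute)
  qed
  finally show ?thesis .
qed

text \<open>The two Dirac terms separate. In the accepted one, multiplying the acceptance
  probability by the proposal density gives the denominator-free minimum.\<close>

lemma accepted_rejected_split:
  assumes l: "l \<in> M" and x: "x \<in> space (X l)"
  shows "ennreal (p (fst x)) * (G B l x * indicator A (fst x))
      = indicator A (fst x) * indicator B (sm l x) *
          min (ennreal (g l x)) (ennreal (g (r l) (T l x)) * ennreal (f l x))
        + indicator A (fst x) * indicator B (fst x) *
          (ennreal (g l x) * ennreal (1 - a l (fst x) (snd x)))"
proof -
  obtain s u where su: "x = (s, u)" by (cases x)
  note nn = all_nonneg[OF l x[unfolded su]]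
  have "ennreal (g l x) * ennreal (a l s u) = ennreal (min (g l x) (g (r l) (T l x) * f l x))"
    using flow_times_acceptance[where p = p and q = q and r = r and k = k and sm = sm and um = um and f = f, OF nn]
      g_ge_0[OF l x] a_bounds[OF l x[unfolded su]]
    by (simp add: g_def su a_def T_def move_map_def flip: ennreal_mult)
  \<comment> \<open>Products and the minimum pass from the reals to \<open>ennreal\<close> because
    every factor is nonnegative.\<close>
  also have "\<dots> = min (ennreal (g l x)) (ennreal (g (r l) (T l x)) * ennreal (f l x))"
    using g_ge_0[OF l x] g_ge_0[OF r_closed[OF l] measurable_space[OF measurable_T[OF l] x]] f_ge_0[OF l x]
    by (simp add: min_def ennreal_le_iff flip: ennreal_mult)
  finally have fl: "min (ennreal (g l x)) (ennreal (g (r l) (T l x)) * ennreal (f l x))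
      = ennreal (g l x) * ennreal (a l s u)" ..
  have "ennreal (g l x) = ennreal (p s) * ennreal (q l s) * ennreal (k l (s, u))"
    using nn by (simp add: g_def su ennreal_mult)
  then show ?thesis
    unfolding fl by (simp add: G_def su algebra_simps)
qed

section \<open>The joint measure of a rectangle and its symmetry\<close>

lemma kernel_rect_eq:
  assumes A: "A \<in> sets \<Lambda>" and B: "B \<in> sets \<Lambda>"
  shows "kernel_rect P \<mu> A B = (\<integral>\<^sup>+ l. flow A B l + stay A B l \<partial>count_space M)"
proof -
  note [measurable] = measurable_p measurable_emeasure_\<mu>[OF B] A B
  have "kernel_rect P \<mu> A B = (\<integral>\<^sup>+ s. ennreal (p s) * (emeasure (\<mu> s) B * indicator A s) \<partial>\<Lambda>)"
    unfolding kernel_rect_def P_density \<Lambda>_def[symmetric] by (subst nn_integral_density) auto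
  also have "\<dots> = (\<integral>\<^sup>+ s. \<integral>\<^sup>+ l. ennreal (p s) * ((if s \<in> space (S l) then \<integral>\<^sup>+ u. G B l (s, u) \<partial>\<nu> l else 0)
      * indicator A s) \<partial>count_space M \<partial>\<Lambda>)"
    by (simp add: emeasure_\<mu>_G[OF B] nn_integral_cmult nn_integral_multc)
  \<comment> \<open>Countability of the set of moves allows the sum over moves to be exchanged with
    the integral over states.\<close>
  also have "\<dots> = (\<integral>\<^sup>+ l. \<integral>\<^sup>+ s. ennreal (p s) * ((if s \<in> space (S l) then \<integral>\<^sup>+ u. G B l (s, u) \<partial>\<nu> l else 0)
      * indicator A s) \<partial>\<Lambda> \<partial>count_space M)"
  proof (rule nn_integral_count_space_nn_integral[OF M_countable])
    fix l assume "l \<in> M"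
    note [measurable] = measurable_move_term[OF this B]
    show "(\<lambda>s. ennreal (p s) * ((if s \<in> space (S l) then \<integral>\<^sup>+ u. G B l (s, u) \<partial>\<nu> l else 0)
      * indicator A s)) \<in> borel_measurable \<Lambda>"
      by measurable
  qed
  also have "\<dots> = (\<integral>\<^sup>+ l. flow A B l + stay A B l \<partial>count_space M)"
  proof (rule nn_integral_cong)
    fix l assume "l \<in> space (count_space M)"
    then have l: "l \<in> M" by simp
    note [measurable] = measurable_sm[OF l] measurable_fst_X[OF l] measurable_a[OF l] measurable_g[OF l] measurable_f[OF l] measurable_G[OF l B]
      measurable_compose[OF measurable_T[OF l] measurable_g[OF r_closed[OF l]]]
      measurable_compose[OF measurable_fst_X[OF l] measurable_p] measurable_restrict_S[OF measurable_p l]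
    have "(\<integral>\<^sup>+ s. ennreal (p s) * ((if s \<in> space (S l) then \<integral>\<^sup>+ u. G B l (s, u) \<partial>\<nu> l else 0)
        * indicator A s) \<partial>\<Lambda>)
      = (\<integral>\<^sup>+ s. ennreal (p s) * ((\<integral>\<^sup>+ u. G B l (s, u) \<partial>\<nu> l) * indicator A s) * indicator (space (S l)) s \<partial>\<Lambda>)"
      by (intro nn_integral_cong) (auto simp: indicator_def)
    \<comment> \<open>The integrand vanishes off the source component, where the mixture measure is
      just \<open>S l\<close>.\<close>
    also have "\<dots> = (\<integral>\<^sup>+ s. ennreal (p s) * ((\<integral>\<^sup>+ u. G B l (s, u) \<partial>\<nu> l) * indicator A s) \<partial>S l)"
      by (simp add: nn_integral_restrict_space[OF space_S_Int_sets[OF l], symmetric] restrict_space_S[OF l])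
    also have "\<dots> = (\<integral>\<^sup>+ s. \<integral>\<^sup>+ u. ennreal (p s) * (G B l (s, u) * indicator A s) \<partial>\<nu> l \<partial>S l)"
    proof (rule nn_integral_cong)
      fix s assume s: "s \<in> space (S l)"
      note [measurable] = measurable_compose[OF measurable_Pair_X[OF s] measurable_G[OF l B]]
      show "ennreal (p s) * ((\<integral>\<^sup>+ u. G B l (s, u) \<partial>\<nu> l) * indicator A s)
          = (\<integral>\<^sup>+ u. ennreal (p s) * (G B l (s, u) * indicator A s) \<partial>\<nu> l)"
        by (simp add: nn_integral_cmult nn_integral_multc)
    qed
    \<comment> \<open>Tonelli, using sigma-finiteness of the measure on the auxiliary space.\<close>
    also have "\<dots> = (\<integral>\<^sup>+ x. ennreal (p (fst x)) * (G B l x * indicator A (fst x)) \<partial>X l)"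
    proof -
      have "(\<lambda>x. ennreal (p (fst x)) * (G B l x * indicator A (fst x))) \<in> borel_measurable (S l \<Otimes>\<^sub>M \<nu> l)"
        unfolding X_def[symmetric] by measurable
      from sigma_finite_measure.nn_integral_fst[OF \<nu>_sigma_finite[OF l] this]
      show ?thesis by (simp add: X_def)
    qed
    also have "\<dots> = flow A B l + stay A B l"
      unfolding flow_def stay_def
      by (subst nn_integral_add[symmetric], measurable) (rule nn_integral_cong, rule accepted_rejected_split[OF l])
    finally show "(\<integral>\<^sup>+ s. ennreal (p s) * ((if s \<in> space (S l) then \<integral>\<^sup>+ u. G B l (s, u) \<partial>\<nu> l else 0)
        * indicator A s) \<partial>\<Lambda>) = flow A B l + stay A B l" .
  qed
  finally show ?thesis .
qed

text \<open>Rejected mass is symmetric for each move separately. Accepted mass of a move is matched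
  by that of its backward move, so its symmetry appears after summing over all moves and reindexing
  along the bijection \<open>r\<close>.\<close>

lemma kernel_rect_sym:
  assumes A: "A \<in> sets \<Lambda>" and B: "B \<in> sets \<Lambda>"
  shows "kernel_rect P \<mu> A B = kernel_rect P \<mu> B A"
proof -
  have "(\<integral>\<^sup>+ l. flow A B l \<partial>count_space M) = (\<integral>\<^sup>+ l. flow B A (r l) \<partial>count_space M)"
    using flow_backward[OF _ A B] by (intro nn_integral_cong) simp
  also have "\<dots> = (\<integral>\<^sup>+ l. flow B A l \<partial>count_space M)"
    by (rule nn_integral_bij_count_space[OF r_bij])
  finally show ?thesis
    by (simp add: kernel_rect_eq A B nn_integral_add stay_commute[of A B])
qed

lemma detailed_balance: "preserves_detailed_balance \<Lambda> P \<mu>"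
  unfolding preserves_detailed_balance_def using markov_kernel_\<mu> kernel_rect_sym by blast

end

theorem lemma3:
  fixes D :: "'d set"
    and lam :: "'d \<Rightarrow> 's measure"
    and P :: "'s measure"
    and p :: "'s \<Rightarrow> real"
    and M :: "'l set"
    and r :: "'l \<Rightarrow> 'l"
    and src tgt :: "'l \<Rightarrow> 'd"
    and q :: "'l \<Rightarrow> 's \<Rightarrow> real"
    and \<nu> :: "'l \<Rightarrow> 'u measure"
    and k :: "'l \<Rightarrow> 's \<times> 'u \<Rightarrow> real"
    and sm :: "'l \<Rightarrow> 's \<times> 'u \<Rightarrow> 's"
    and um :: "'l \<Rightarrow> 's \<times> 'u \<Rightarrow> 'u"
    and f :: "'l \<Rightarrow> 's \<times> 'u \<Rightarrow> real"
  assumes D_countable: "countable D"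
    and lam_sigma_finite: "\<And>i. i \<in> D \<Longrightarrow> sigma_finite_measure (lam i)"
    and lam_disjoint: "disjoint_family_on (\<lambda>i. space (lam i)) D"
    and P_prob: "prob_space P"
    and p_measurable: "p \<in> borel_measurable (mixture_measure D lam)"
    and p_nonneg: "\<And>s. s \<in> space (mixture_measure D lam) \<Longrightarrow> 0 \<le> p s"
    and P_density: "P = density (mixture_measure D lam) (\<lambda>s. ennreal (p s))"
    and M_countable: "countable M"
    and r_bij: "bij_betw r M M"
    and r_invol: "\<And>l. l \<in> M \<Longrightarrow> r (r l) = l"
    and src_in: "\<And>l. l \<in> M \<Longrightarrow> src l \<in> D"
    and tgt_in: "\<And>l. l \<in> M \<Longrightarrow> tgt l \<in> D"
    and src_backward: "\<And>l. l \<in> M \<Longrightarrow> src (r l) = tgt l"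
    and tgt_backward: "\<And>l. l \<in> M \<Longrightarrow> tgt (r l) = src l"
    and q_measurable: "\<And>l. l \<in> M \<Longrightarrow> q l \<in> borel_measurable (mixture_measure D lam)"
    and q_range: "\<And>l s. l \<in> M \<Longrightarrow> s \<in> space (mixture_measure D lam) \<Longrightarrow> q l s \<in> {0..1}"
    and q_sum: "\<And>s. s \<in> space (mixture_measure D lam) \<Longrightarrow> ((\<lambda>l. q l s) has_sum 1) M"
    and q_zero: "\<And>l s. l \<in> M \<Longrightarrow> s \<in> space (mixture_measure D lam) \<Longrightarrow>
                   s \<notin> space (lam (src l)) \<Longrightarrow> q l s = 0"
    and \<nu>_sigma_finite: "\<And>l. l \<in> M \<Longrightarrow> sigma_finite_measure (\<nu> l)"
    and k_density: "\<And>l. l \<in> M \<Longrightarrow> kernel_density (lam (src l)) (\<nu> l) (k l)"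
    and sm_measurable: "\<And>l. l \<in> M \<Longrightarrow>
          sm l \<in> measurable (lam (src l) \<Otimes>\<^sub>M \<nu> l) (lam (tgt l))"
    and um_measurable: "\<And>l. l \<in> M \<Longrightarrow>
          um l \<in> measurable (lam (src l) \<Otimes>\<^sub>M \<nu> l) (\<nu> (r l))"
    and f_measurable: "\<And>l. l \<in> M \<Longrightarrow> f l \<in> borel_measurable (lam (src l) \<Otimes>\<^sub>M \<nu> l)"
    and f_nonneg: "\<And>l x. l \<in> M \<Longrightarrow> x \<in> space (lam (src l) \<Otimes>\<^sub>M \<nu> l) \<Longrightarrow> 0 \<le> f l x"
    and map_bij: "\<And>l. l \<in> M \<Longrightarrow>
          bij_betw (move_map sm um l) (space (lam (src l) \<Otimes>\<^sub>M \<nu> l))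
            (space (lam (tgt l) \<Otimes>\<^sub>M \<nu> (r l)))"
    and map_inverse: "\<And>l x. l \<in> M \<Longrightarrow> x \<in> space (lam (src l) \<Otimes>\<^sub>M \<nu> l) \<Longrightarrow>
          move_map sm um (r l) (move_map sm um l x) = x"
    and map_image_measure: "\<And>l C. l \<in> M \<Longrightarrow> C \<in> sets (lam (src l) \<Otimes>\<^sub>M \<nu> l) \<Longrightarrow>
          emeasure (lam (tgt l) \<Otimes>\<^sub>M \<nu> (r l)) (move_map sm um l ` C)
            = (\<integral>\<^sup>+ x\<in>C. ennreal (f l x) \<partial>(lam (src l) \<Otimes>\<^sub>M \<nu> l))"
  shows "preserves_detailed_balance (mixture_measure D lam) P
           (transition_kernel (mixture_measure D lam) M (\<lambda>l. lam (src l)) \<nu> q k sm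
              (acceptance p q r k sm um f))"
proof -
  interpret posthoc_translations D lam P p M r src tgt q \<nu> k sm um f
    by (rule posthoc_translations.intro) (fact assms)+
  show ?thesis
    using detailed_balance unfolding \<mu>_def \<Lambda>_def S_def[abs_def] a_def .
qed

end
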